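(* Let $(A,\triangleright,\triangleleft,\diamond)$ be an NS-Leibniz algebra. Then the vector space $A$ with the bilinear operation $[\cdot,\cdot]_\ast:A\otimes A\to A$, $[x,y]_\ast:=x\ast y=x\triangleright y+x\triangleleft y+x\diamond y$, is a Leibniz algebra.
   Context: All vector spaces are finite-dimensional over $\mathbb{C}$. A Leibniz algebra is a vector space $\mathfrak{g}$ with a bilinear bracket satisfying $[x,[y,z]]=[[x,y],z]+[y,[x,z]]$ for all $x,y,z\in\mathfrak{g}$. An NS-Leibniz algebra is a vector space $A$ with three bilinear operations $\triangleright,\triangleleft,\diamond:A\otimes A\to A$ such that, with $x\ast y=x\triangleright y+x\triangleleft y+x\diamond y$, for all $x,y,z\in A$: (A1) $x\triangleright(y\ast z)=(x\triangleright y)\triangleright z+y\triangleleft(x\triangleright z)$; (A2) $x\triangleleft(y\triangleright z)=(x\triangleleft y)\triangleright z+y\triangleright(x\ast z)$; (A3) $x\triangleleft(y\triangleleft z)=(x\ast y)\triangleleft z+y\triangleleft(x\triangleleft z)$; (A4) $x\triangleleft(y\diamond z)+x\diamond(y\ast z)=(x\diamond y)\triangleright z+(x\ast y)\diamond z+y\triangleleft(x\diamond z)+y\diamond(x\ast z)$. *)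

theory Defs
  imports Complex_Main
begin

text \<open>
  A complex vector space is a type of class \<open>ab_group_add\<close> together with a scalar multiplication;
  \<open>module.span\<close> is the library's linear span.
\<close>

locale fin_dim_complex_space = vector_space scale
  for scale :: "complex \<Rightarrow> 'a::ab_group_add \<Rightarrow> 'a" +
  assumes finite_dimensional: "\<exists>B. finite B \<and> module.span scale B = UNIV"

definition bilinear_op ::
  "(complex \<Rightarrow> 'a::ab_group_add \<Rightarrow> 'a) \<Rightarrow> ('a \<Rightarrow> 'a \<Rightarrow> 'a) \<Rightarrow> bool" where
  "bilinear_op scale f \<longleftrightarrow>
     (\<forall>x. Vector_Spaces.linear scale scale (\<lambda>y. f x y)) \<and>
     (\<forall>y. Vector_Spaces.linear scale scale (\<lambda>x. f x y))"

locale leibniz_algebra = fin_dim_complex_space scale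
  for scale :: "complex \<Rightarrow> 'a::ab_group_add \<Rightarrow> 'a" +
  fixes bracket :: "'a \<Rightarrow> 'a \<Rightarrow> 'a"
  assumes bilinear_bracket: "bilinear_op scale bracket"
    and leibniz_identity:
      "bracket x (bracket y z) = bracket (bracket x y) z + bracket y (bracket x z)"

definition ns_product ::
  "('a::ab_group_add \<Rightarrow> 'a \<Rightarrow> 'a) \<Rightarrow> ('a \<Rightarrow> 'a \<Rightarrow> 'a) \<Rightarrow> ('a \<Rightarrow> 'a \<Rightarrow> 'a) \<Rightarrow> 'a \<Rightarrow> 'a \<Rightarrow> 'a" where
  "ns_product r l d x y = r x y + l x y + d x y"

locale ns_leibniz_algebra = fin_dim_complex_space scale
  for scale :: "complex \<Rightarrow> 'a::ab_group_add \<Rightarrow> 'a" +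
  fixes rtri :: "'a \<Rightarrow> 'a \<Rightarrow> 'a"  (infixl \<open>\<triangleright>\<close> 70)
    and ltri :: "'a \<Rightarrow> 'a \<Rightarrow> 'a"  (infixl \<open>\<triangleleft>\<close> 70)
    and diam :: "'a \<Rightarrow> 'a \<Rightarrow> 'a"  (infixl \<open>\<diamondop>\<close> 70)
    and star :: "'a \<Rightarrow> 'a \<Rightarrow> 'a"  (infixl \<open>\<star>\<close> 70)
  defines "star \<equiv> ns_product rtri ltri diam"
  assumes bilinear_rtri: "bilinear_op scale rtri"
    and bilinear_ltri: "bilinear_op scale ltri"
    and bilinear_diam: "bilinear_op scale diam"
    and A1: "x \<triangleright> (y \<star> z) = (x \<triangleright> y) \<triangleright> z + y \<triangleleft> (x \<triangleright> z)"
    and A2: "x \<triangleleft> (y \<triangleright> z) = (x \<triangleleft> y) \<triangleright> z + y \<triangleright> (x \<star> z)"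
    and A3: "x \<triangleleft> (y \<triangleleft> z) = (x \<star> y) \<triangleleft> z + y \<triangleleft> (x \<triangleleft> z)"
    and A4: "x \<triangleleft> (y \<diamondop> z) + x \<diamondop> (y \<star> z) =
             (x \<diamondop> y) \<triangleright> z + (x \<star> y) \<diamondop> z + y \<triangleleft> (x \<diamondop> z) + y \<diamondop> (x \<star> z)"

end

theory Submission
  imports Defs
begin

text \<open>The Leibniz identity for the total product is the sum of
  \<open>A1\<close>-\<open>A4\<close>. By additivity, the left sides add up to x * (y * z). On the
  right, \<open>A1\<close>, \<open>A2\<close> and \<open>A4\<close> each give one summand of (x * y)
  \<triangleright> z, and \<open>A1\<close>, \<open>A3\<close> and \<open>A4\<close> each give one
  of y \<triangleleft> (x * z); the other four terms complete (x * y) * z + y * (x * z).\<close>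

lemma bilinear_op_add_right: "bilinear_op s f \<Longrightarrow> f x (y + z) = f x y + f x z"
  by (simp add: bilinear_op_def Vector_Spaces.linear_iff)

lemma bilinear_op_add_left: "bilinear_op s f \<Longrightarrow> f (x + y) z = f x z + f y z"
  by (simp add: bilinear_op_def Vector_Spaces.linear_iff)

lemma bilinear_op_add:
  "bilinear_op s f \<Longrightarrow> bilinear_op s g \<Longrightarrow> bilinear_op s (\<lambda>x y. f x y + g x y)"
  by (simp add: bilinear_op_def linear_iff_module_hom module_hom_iff module.scale_right_distrib)

theorem proposition5p2:
  fixes scale :: "complex \<Rightarrow> 'a::ab_group_add \<Rightarrow> 'a"
    and rtri ltri diam :: "'a \<Rightarrow> 'a \<Rightarrow> 'a"
  assumes "ns_leibniz_algebra scale rtri ltri diam"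
  shows "leibniz_algebra scale (\<lambda>x y. rtri x y + ltri x y + diam x y)"
proof -
  \<comment> \<open>\<open>star\<close> is fixed by \<open>defines\<close>: the locale predicate
    does not take it, but the interpretation names its value.\<close>
  interpret ns_leibniz_algebra scale rtri ltri diam "ns_product rtri ltri diam"
    by (rule assms)
  note bil = bilinear_rtri bilinear_ltri bilinear_diam
  note add = bil[THEN bilinear_op_add_left] bil[THEN bilinear_op_add_right]
  show ?thesis
  proof unfold_locales
    show "bilinear_op scale (\<lambda>x y. rtri x y + ltri x y + diam x y)"
      by (intro bilinear_op_add bil)
  next
    fix x y z
    let ?s = "ns_product rtri ltri diam"
    \<comment> \<open>The summands are grouped as the left sides of \<open>A1\<close>,
      \<open>A2\<close>, \<open>A3\<close> and \<open>A4\<close>, in this order.\<close>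
    have "?s x (?s y z) = rtri x (?s y z) + ltri x (rtri y z) + ltri x (ltri y z)
        + (ltri x (diam y z) + diam x (?s y z))"
      by (simp add: ns_product_def[of _ _ _ x] ns_product_def[of _ _ _ y z] add ac_simps)
    also have "\<dots> = ?s (?s x y) z + ?s y (?s x z)"
      \<comment> \<open>The axioms are instantiated because, as a general rewrite rule,
        \<open>A3\<close> would apply again to its own last term with x and y swapped.\<close>
      unfolding A1[of x y z] A2[of x y z] A3[of x y z] A4[of x y z]
      by (simp add: ns_product_def add ac_simps)
    finally show "rtri x (rtri y z + ltri y z + diam y z) + ltri x (rtri y z + ltri y z + diam y z)
        + diam x (rtri y z + ltri y z + diam y z)
      = rtri (rtri x y + ltri x y + diam x y) z + ltri (rtri x y + ltri x y + diam x y) z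
        + diam (rtri x y + ltri x y + diam x y) z
        + (rtri y (rtri x z + ltri x z + diam x z) + ltri y (rtri x z + ltri x z + diam x z)
        + diam y (rtri x z + ltri x z + diam x z))"
      by (simp add: ns_product_def)
  qed
qed

end
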